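(* Let $f:\mathbb{N}_0\to\mathbb{C}$ with $f(0)\neq 0$. Then the identity $$(-1)^n(I\otimes_{\psi_m} f)(n)=(-1)^m(I\otimes_{\psi_n} f)(m)\quad\text{for all } m,n\in\mathbb{N}_0,$$ equivalently $(-1)^n\sum_{i=0}^n\binom{n}{i}f(m+i)=(-1)^m\sum_{i=0}^m\binom{m}{i}f(n+i)$ for all $m,n\in\mathbb{N}_0$, holds if and only if $I\bullet f=\nu f$, i.e. $\sum_{j=0}^k\binom{k}{j}f(j)=(-1)^kf(k)$ for all $k\in\mathbb{N}_0$. Furthermore, any such $f$ is determined by its values on the even nonnegative integers; precisely, for all $k\in\mathbb{N}_0$, $$f(2k+1)=-\sum_{i=0}^{k}\binom{2k+1}{2i+1}E_{2i+1}(1)\,f(2(k-i)).$$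
   Context: $\mathbb{N}_0$ is the set of nonnegative integers; an arithmetic function is a map $\mathbb{N}_0\to\mathbb{C}$. The Cauchy-type product is $(f\bullet g)(k):=\sum_{m=0}^{k}\binom{k}{m}f(m)g(k-m)$. $I$ is the arithmetic function with $I(k)=1$ for all $k$, $\nu(k)=(-1)^k$, and $(\nu f)(k):=(-1)^kf(k)$ (pointwise product). For $m\in\mathbb{N}_0$, $\psi_m:\mathbb{N}_0\to\mathbb{N}_0$ is $\psi_m(n)=m+n$, and $(f\otimes_{\psi_m}g)(n):=((f\circ\psi_m)\bullet(g\circ\psi_m))(n)$, where $\circ$ is composition of maps. $E_k(x)$ denotes the $k$th Euler polynomial, defined by $\frac{2e^{xt}}{e^t+1}=\sum_{k=0}^\infty E_k(x)\frac{t^k}{k!}$. *)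

theory Defs
  imports Complex_Main "HOL-Computational_Algebra.Formal_Power_Series"
begin

type_synonym arith_fun = "nat \<Rightarrow> complex"

definition cauchy_prod :: "arith_fun \<Rightarrow> arith_fun \<Rightarrow> arith_fun" where
  "cauchy_prod f g = (\<lambda>k. \<Sum>m\<le>k. of_nat (k choose m) * f m * g (k - m))"

definition const_one :: arith_fun where
  "const_one = (\<lambda>k. 1)"

definition nu :: arith_fun where
  "nu = (\<lambda>k. (- 1) ^ k)"

definition pointwise_prod :: "arith_fun \<Rightarrow> arith_fun \<Rightarrow> arith_fun" where
  "pointwise_prod f g = (\<lambda>k. f k * g k)"

definition psi :: "nat \<Rightarrow> nat \<Rightarrow> nat" where
  "psi m = (\<lambda>n. m + n)"

definition otimes_via :: "(nat \<Rightarrow> nat) \<Rightarrow> arith_fun \<Rightarrow> arith_fun \<Rightarrow> arith_fun" where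
  "otimes_via p f g = cauchy_prod (f \<circ> p) (g \<circ> p)"

text \<open>
  The value \<open>E\<^sub>k(x)\<close> of the Euler polynomial is read off, for each fixed \<open>x\<close>, from the exponential
  generating function \<open>2 e\<^sup>x\<^sup>t / (e\<^sup>t + 1)\<close>, taken as a formal power series in \<open>t\<close>. The denominator
  has constant term 2, so the quotient is a genuine one (see \<open>euler_poly_generating_function\<close>).
\<close>

definition euler_poly :: "nat \<Rightarrow> complex \<Rightarrow> complex" where
  "euler_poly k x = fact k * fps_nth (2 * fps_exp x / (fps_exp 1 + 1)) k"

lemma euler_poly_generating_function:
  "Abs_fps (\<lambda>k. euler_poly k x / fact k) * (fps_exp 1 + 1) = 2 * fps_exp x"
proof -
  have "Abs_fps (\<lambda>k. euler_poly k x / fact k) = 2 * fps_exp x / (fps_exp 1 + 1)"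
    by (rule fps_ext) (simp add: euler_poly_def)
  moreover have "is_unit (fps_exp 1 + 1 :: complex fps)"
    by simp
  ultimately show ?thesis
    by (metis dvd_div_mult_self unit_imp_dvd)
qed

end

theory Submission
  imports Defs
begin

text \<open>
  Pascal's rule turns the numbers \<open>S(m,n) = (-1)\<^sup>n (I \<otimes> f)(n)\<close>, with shift \<open>m\<close>, into a solution of
  the symmetric recurrence \<open>S(m,n) + S(m+1,n) + S(m,n+1) = 0\<close>. Such an array is symmetric as soon as
  its first row and first column agree, which is exactly \<open>I \<bullet> f = \<nu> f\<close>. For the formula, let \<open>F\<close> be the
  exponential generating function of \<open>f\<close>, so that \<open>e\<^sup>t F(t) = F(-t)\<close>, and let \<open>H = 2e\<^sup>t/(e\<^sup>t + 1)\<close> be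
  that of \<open>E\<^sub>k(1)\<close>. Then \<open>H(t) (F(t) + F(-t)) = H(t) (1 + e\<^sup>t) F(t) = 2 e\<^sup>t F(t) = 2 F(-t)\<close>, and the odd
  coefficients of the outer terms express odd values of \<open>f\<close> through even ones.
\<close>

definition egf :: "arith_fun \<Rightarrow> complex fps" where
  "egf f = Abs_fps (\<lambda>k. f k / fact k)"

lemma egf_nth [simp]: "fps_nth (egf f) k = f k / fact k"
  by (simp add: egf_def)

lemma egf_inject: "egf f = egf g \<longleftrightarrow> f = g"
  by (auto simp: fps_eq_iff)

lemma egf_add: "egf (\<lambda>k. f k + g k) = egf f + egf g"
  by (rule fps_ext) (simp add: add_divide_distrib)

text \<open>Dividing \<open>k choose i\<close> by \<open>fact k\<close> leaves
  \<open>1 / (fact i * fact (k - i))\<close>, one factor for each series.\<close>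

lemma egf_cauchy_prod: "egf (cauchy_prod f g) = egf f * egf g"
proof (rule fps_ext)
  fix k
  have "of_nat (k choose i) * f i * g (k - i) / fact k = f i / fact i * (g (k - i) / fact (k - i))"
    if "i \<le> k" for i
    using that by (simp add: binomial_fact field_simps)
  then show "fps_nth (egf (cauchy_prod f g)) k = fps_nth (egf f * egf g) k"
    by (simp add: fps_mult_nth cauchy_prod_def sum_divide_distrib atLeast0AtMost)
qed

lemma cauchy_prod_const_one:
  "cauchy_prod const_one f k = (\<Sum>j\<le>k. of_nat (k choose j) * f j)"
  unfolding cauchy_prod_def const_one_def
  by (rule sum.reindex_bij_witness[of _ "\<lambda>j. k - j" "\<lambda>j. k - j"])
     (auto simp: binomial_symmetric[symmetric])

lemma otimes_via_const_one:
  "otimes_via (psi m) const_one f n = (\<Sum>i\<le>n. of_nat (n choose i) * f (m + i))"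
proof -
  have "otimes_via (psi m) const_one f n = cauchy_prod const_one (f \<circ> psi m) n"
    by (simp add: otimes_via_def const_one_def o_def)
  then show ?thesis
    by (simp add: cauchy_prod_const_one psi_def)
qed

lemma binomial_sum_Suc:
  fixes g :: arith_fun
  shows "(\<Sum>i\<le>Suc n. of_nat (Suc n choose i) * g i)
    = (\<Sum>i\<le>n. of_nat (n choose i) * g i) + (\<Sum>i\<le>n. of_nat (n choose i) * g (Suc i))"
proof -
  have "(\<Sum>i\<le>Suc n. of_nat (Suc n choose i) * g i)
      = g 0 + (\<Sum>i\<le>n. of_nat (n choose Suc i) * g (Suc i))
        + (\<Sum>i\<le>n. of_nat (n choose i) * g (Suc i))"
    by (simp add: sum.atMost_Suc_shift ring_distribs sum.distrib del: sum.atMost_Suc)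
  \<comment> \<open>Here \<open>g 0\<close> is the missing bottom term; the top term vanishes
    because \<open>n choose Suc n\<close> is 0.\<close>
  also have "g 0 + (\<Sum>i\<le>n. of_nat (n choose Suc i) * g (Suc i))
      = (\<Sum>i\<le>Suc n. of_nat (n choose i) * g i)"
    by (simp add: sum.atMost_Suc_shift del: sum.atMost_Suc)
  finally show ?thesis
    by simp
qed

text \<open>The recurrence computes row \<open>Suc m\<close> from row \<open>m\<close>, and column
  \<open>Suc m\<close> from column \<open>m\<close> in the same way, so agreement passes from
  \<open>m\<close> to \<open>Suc m\<close>.\<close>

lemma symmetric_recurrence_symmetric:
  fixes S :: "nat \<Rightarrow> nat \<Rightarrow> 'a::ab_group_add"
  assumes rec: "\<And>m n. S m n + S (Suc m) n + S m (Suc n) = 0"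
    and boundary: "\<And>n. S 0 n = S n 0"
  shows "S m n = S n m"
proof (induction m arbitrary: n)
  case (Suc m)
  have "S m n + S (Suc m) n + S m (Suc n) = S n m + S n (Suc m) + S (Suc n) m"
    using rec[of m n] rec[of n m] by (simp add: algebra_simps)
  then show ?case
    by (simp add: Suc.IH)
qed (fact boundary)

lemma shifted_binomial_sum_symmetric_iff:
  fixes f :: arith_fun
  defines "S \<equiv> \<lambda>m n. (- 1) ^ n * (\<Sum>i\<le>n. of_nat (n choose i) * f (m + i))"
  shows "(\<forall>m n. S m n = S n m)
    \<longleftrightarrow> (\<forall>k. (\<Sum>j\<le>k. of_nat (k choose j) * f j) = (- 1) ^ k * f k)"
proof -
  have rec: "S m n + S (Suc m) n + S m (Suc n) = 0" for m n
    using binomial_sum_Suc[of n "\<lambda>i. f (m + i)"]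
    by (simp add: S_def algebra_simps del: sum.atMost_Suc)
  have "(\<forall>m n. S m n = S n m) \<longleftrightarrow> (\<forall>n. S 0 n = S n 0)"
    using symmetric_recurrence_symmetric[of S, OF rec] by blast
  also have "\<dots> \<longleftrightarrow> (\<forall>k. (\<Sum>j\<le>k. of_nat (k choose j) * f j) = (- 1) ^ k * f k)"
  proof (rule iff_allI)
    fix n
    show "S 0 n = S n 0 \<longleftrightarrow> (\<Sum>j\<le>n. of_nat (n choose j) * f j) = (- 1) ^ n * f n"
      \<comment> \<open>\<open>S n 0\<close> is just \<open>f n\<close>; the parity split moves the
        sign in \<open>S 0 n\<close> across the equation.\<close>
      by (cases "even n") (auto simp: S_def minus_equation_iff[of _ "f n"])
  qed
  finally show ?thesis .
qed

lemma cauchy_prod_euler_poly_one: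
  assumes "cauchy_prod const_one f = pointwise_prod nu f"
  shows "cauchy_prod (\<lambda>k. euler_poly k 1) (\<lambda>k. f k + (- 1) ^ k * f k) = (\<lambda>k. 2 * ((- 1) ^ k * f k))"
proof -
  define h where "h = egf (\<lambda>k. euler_poly k 1)"
  define e :: "complex fps" where "e = fps_exp 1"
  define F where "F = egf f"
  define G where "G = egf (\<lambda>k. (- 1) ^ k * f k)"
  have h: "h * (e + 1) = 2 * e"
    unfolding h_def e_def egf_def by (rule euler_poly_generating_function)
  have "egf const_one = e"
    by (rule fps_ext) (simp add: const_one_def e_def)
  moreover have "pointwise_prod nu f = (\<lambda>k. (- 1) ^ k * f k)"
    by (simp add: pointwise_prod_def nu_def)
  \<comment> \<open>\<open>G\<close> is F(-t), so this is the hypothesis on \<open>f\<close> read as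
    an identity of series.\<close>
  ultimately have G: "G = e * F"
    unfolding F_def G_def by (metis assms egf_cauchy_prod)
  have "h * (F + G) = h * (e + 1) * F"
    by (simp add: G algebra_simps)
  also have "\<dots> = G + G"
    by (simp only: h G) (simp add: algebra_simps)
  finally have "h * (F + G) = G + G" .
  then show ?thesis
    unfolding h_def F_def G_def by (simp flip: egf_add egf_cauchy_prod add: egf_inject mult.commute)
qed

lemma odd_value_euler_poly:
  assumes "cauchy_prod const_one f = pointwise_prod nu f"
  shows "f (2 * k + 1) =
    - (\<Sum>i\<le>k. of_nat ((2 * k + 1) choose (2 * i + 1)) * euler_poly (2 * i + 1) 1 * f (2 * (k - i)))"
    (is "_ = - (\<Sum>i\<le>k. ?a i)")
proof -
  define b where "b = (\<lambda>j. of_nat ((2 * k + 1) choose j) * euler_poly j 1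
    * (f (2 * k + 1 - j) + (- 1) ^ (2 * k + 1 - j) * f (2 * k + 1 - j)))"
  \<comment> \<open>The argument of \<open>f\<close> is odd here, since the bound prevents
    truncation of the subtraction, and the two summands cancel.\<close>
  have even: "b (2 * i) = 0" if "i \<le> k" for i
  proof -
    have "odd (2 * k + 1 - 2 * i)"
      using that by simp
    then show ?thesis
      by (simp add: b_def)
  qed
  have odd: "b (2 * i + 1) = 2 * ?a i" for i
  proof -
    have "2 * k + 1 - (2 * i + 1) = 2 * (k - i)"
      by simp
    then show ?thesis
      unfolding b_def by (simp only:) simp
  qed
  have split: "(\<Sum>j\<le>2 * k + 1. c j) = (\<Sum>i\<le>k. c (2 * i) + c (2 * i + 1))" for c :: arith_fun
    by (induction k) (simp_all add: add.assoc)
  \<comment> \<open>Compare coefficients at an odd index, where the sign on the right is -1.\<close>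
  have "- (2 * f (2 * k + 1)) = (\<Sum>j\<le>2 * k + 1. b j)"
    using fun_cong[OF cauchy_prod_euler_poly_one[OF assms], of "2 * k + 1"]
    by (simp add: cauchy_prod_def b_def)
  also have "\<dots> = 2 * (\<Sum>i\<le>k. ?a i)"
    unfolding split sum_distrib_left by (rule sum.cong) (simp_all only: even odd atMost_iff add_0)
  finally have "- f (2 * k + 1) = (\<Sum>i\<le>k. ?a i)"
    by (simp only: flip: mult_minus_right) simp
  then show ?thesis
    by (metis minus_minus)
qed

text \<open>The formula for an odd value refers to \<open>f\<close> at even arguments only.\<close>

lemma eq_of_even_values_eq:
  assumes "cauchy_prod const_one f = pointwise_prod nu f"
    and "cauchy_prod const_one g = pointwise_prod nu g"
    and even: "\<And>k. g (2 * k) = f (2 * k)"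
  shows "g = f"
proof
  fix n
  show "g n = f n"
  proof (cases "even n")
    case True
    then show ?thesis
      using even by (metis evenE)
  next
    case False
    then obtain k where "n = 2 * k + 1"
      by (rule oddE)
    then show ?thesis
      by (simp only: odd_value_euler_poly[OF assms(1)] odd_value_euler_poly[OF assms(2)] even)
  qed
qed

theorem theorem5:
  fixes f :: "nat \<Rightarrow> complex"
  assumes "f 0 \<noteq> 0"
  shows
    "((\<forall>m n. (- 1) ^ n * otimes_via (psi m) const_one f n
             = (- 1) ^ m * otimes_via (psi n) const_one f m)
        \<longleftrightarrow> cauchy_prod const_one f = pointwise_prod nu f)
     \<and> ((\<forall>m n. (- 1) ^ n * otimes_via (psi m) const_one f n
             = (- 1) ^ m * otimes_via (psi n) const_one f m)
        \<longleftrightarrow> (\<forall>m n. (- 1) ^ n * (\<Sum>i\<le>n. of_nat (n choose i) * f (m + i))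
                 = (- 1) ^ m * (\<Sum>i\<le>m. of_nat (m choose i) * f (n + i))))
     \<and> (cauchy_prod const_one f = pointwise_prod nu f
        \<longleftrightarrow> (\<forall>k. (\<Sum>j\<le>k. of_nat (k choose j) * f j) = (- 1) ^ k * f k))
     \<and> (cauchy_prod const_one f = pointwise_prod nu f \<longrightarrow>
          (\<forall>g :: nat \<Rightarrow> complex. g 0 \<noteq> 0 \<longrightarrow> cauchy_prod const_one g = pointwise_prod nu g \<longrightarrow>
             (\<forall>k. g (2 * k) = f (2 * k)) \<longrightarrow> g = f)
        \<and> (\<forall>k. f (2 * k + 1) =
             - (\<Sum>i\<le>k. of_nat ((2 * k + 1) choose (2 * i + 1))
                        * euler_poly (2 * i + 1) 1 * f (2 * (k - i)))))"
proof -
  have eigen: "cauchy_prod const_one f = pointwise_prod nu f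
      \<longleftrightarrow> (\<forall>k. (\<Sum>j\<le>k. of_nat (k choose j) * f j) = (- 1) ^ k * f k)"
    by (simp add: fun_eq_iff cauchy_prod_const_one pointwise_prod_def nu_def)
  show ?thesis
    \<comment> \<open>Expanding the shifted products makes both sides of the second conjunct
      coincide.\<close>
    unfolding otimes_via_const_one eigen[symmetric] shifted_binomial_sum_symmetric_iff
    using eq_of_even_values_eq[of f] odd_value_euler_poly[of f] by blast
qed

end
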